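(* Let $T>0$ and let $\Omega\subset\mathbb{R}^n$ be a bounded domain of class $C^2$. Let $F:\Omega\times\mathbb{R}^n\times\mathbb{S}^n\to\mathbb{R}$ satisfy: (i) $F\in C(\Omega\times\mathbb{R}^n\times\mathbb{S}^n)$; (ii) $F(x,p,X)\le F(x,p,Y)$ for all $x\in\Omega$, $p\in\mathbb{R}^n$ and $X,Y\in\mathbb{S}^n$ with $X\ge Y$; (iii) for any modulus of continuity $\omega$, $$\sup\{|F(x,p,X)|:\ x\in\Omega,\ d(x)\le\delta,\ |p|\le\omega(\delta)/\delta,\ |X|\le\omega(\delta)/\delta^2\}\to0\quad\text{as }\delta\to0;$$ (iv) $\sup_{x\in\Omega}|F(x,p,X)|\to0$ as $|p|,|X|\to0$; (v) there exist $a_F,L>0$, $\alpha\in(0,1]$ and $\beta\in(0,1)$ such that for every $M>0$ (with constants independent of $M$) $$F(y,q,Y)-F(x,p,X)\le\beta a_F|x-y|^\alpha+L\delta$$ holds for any $\delta>0$, $x,y\in\Omega$ with $x\ne y$, $p,q\in\mathbb{R}^n$ and $X,Y\in\mathbb{S}^n$ provided that $$F(x,p,X)\le M,\qquad F(y,q,Y)\ge-M,$$ $$|p-\alpha a_F|x-y|^{\alpha-2}(x-y)|\le\delta\,d(x)^{-1},\qquad |q-\alpha a_F|x-y|^{\alpha-2}(x-y)|\le\delta\,d(y)^{-1},$$ and $$\begin{pmatrix}X&0\\0&-Y\end{pmatrix}\le\begin{pmatrix}A&-A\\-A&A\end{pmatrix}+\delta\begin{pmatrix}d(x)^{-2}I_n&0\\0&d(y)^{-2}I_n\end{pmatrix}+\delta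 I_{2n}$$ hold with some $A=A(x,y)\in\mathbb{S}^n$ satisfying $A\le\alpha a_F|x-y|^{\alpha-2}I_n$; (vi) there exist $b_F>0$ and $\ell>0$ such that $$F(y,q,Y)-F(x,p,X)\le b_Fc|x-y|^2+\ell\delta$$ holds for any $c,\delta>0$, $x,y\in\Omega$, $p,q\in\mathbb{R}^n$ and $X,Y\in\mathbb{S}^n$ satisfying $$|p-c(x-y)|\le\frac{\delta}{d(x)},\qquad |q-c(x-y)|\le\frac{\delta}{d(y)},$$ and $$\begin{pmatrix}X&0\\0&-Y\end{pmatrix}\le c\begin{pmatrix}I_n&-I_n\\-I_n&I_n\end{pmatrix}+\delta\begin{pmatrix}d(x)^{-2}I_n&0\\0&d(y)^{-2}I_n\end{pmatrix}+\delta I_{2n}.$$ Let $u\in C(\Omega\times[0,T))$ be a bounded viscosity solution of $$u_t+u+F(x,\nabla u,\nabla^2u)=0\quad\text{in }\Omega\times(0,T)$$ satisfying the initial condition $u(\cdot,0)=0$ in $\Omega$, and suppose that there exists a modulus of continuity $\omega_0:[0,\infty)\to[0,\infty)$, strictly increasing and smooth in $(0,\infty)$, such that $\sup_{x\in\Omega}|u(x,t)|\le\omega_0(t)$ for $t\in[0,T)$. Then $u\equiv0$ in $\Omega\times(0,T)$.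
   Context: $\mathbb{S}^n$ is the set of all real symmetric $n\times n$ matrices with the usual partial order; $I_k$ is the $k\times k$ identity matrix; $d(x)$ denotes the distance from $x\in\overline{\Omega}$ to $\partial\Omega$; $\nabla,\nabla^2$ are the gradient and Hessian in the space variable; $\Omega_T=\Omega\times(0,T)$. A modulus of continuity is a nonnegative increasing function $\omega\in C([0,\infty))$ with $\omega(0)=0$. Viscosity solutions. A locally bounded upper (resp. lower) semicontinuous function $u$ in $\Omega_T$ is a viscosity subsolution (resp. supersolution) of $u_t+u+F(x,\nabla u,\nabla^2u)=0$ in $\Omega_T$ if whenever $(x_0,t_0)\in\Omega_T$ and $\varphi\in C^2(\Omega_T)$ are such that $u-\varphi$ attains a local maximum (resp. minimum) at $(x_0,t_0)$, one has $\varphi_t(x_0,t_0)+u(x_0,t_0)+F(x_0,\nabla\varphi(x_0,t_0),\nabla^2\varphi(x_0,t_0))\le0$ (resp. $\ge0$). A continuous function is a viscosity solution if it is both a viscosity subsolution and a viscosity supersolution. *)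

theory Defs
  imports "HOL-Analysis.Analysis"
begin

text \<open>Intended for open sets \<open>S\<close>, where the gradient \<open>g\<close> and the second derivative \<open>H\<close>
  are unique.\<close>

definition C2_on :: "('a::euclidean_space \<Rightarrow> real) \<Rightarrow> 'a set \<Rightarrow> bool" where
  "C2_on f S \<longleftrightarrow>
    (\<exists>g. \<exists>H :: 'a \<Rightarrow> 'a \<Rightarrow>\<^sub>L 'a.
      (\<forall>z\<in>S. GDERIV f z :> g z) \<and>
      (\<forall>z\<in>S. (g has_derivative blinfun_apply (H z)) (at z)) \<and>
      continuous_on S H)"

definition gradient :: "('a::real_inner \<Rightarrow> real) \<Rightarrow> 'a \<Rightarrow> 'a" where
  "gradient f z = (THE D. GDERIV f z :> D)"

definition hessian :: "(real ^ 'n \<Rightarrow> real) \<Rightarrow> real ^ 'n \<Rightarrow> real ^ 'n ^ 'n" where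
  "hessian f z = jacobian (gradient f) (at z)"

text \<open>Near each boundary point \<open>\<Omega>\<close> is the strict epigraph, in some unit direction \<open>\<nu>\<close>, of a
  \<open>C\<^sup>2\<close> function of the coordinates orthogonal to \<open>\<nu>\<close>.  Such a function is represented by a
  \<open>C\<^sup>2\<close> function \<open>\<gamma>\<close> on the whole space that is constant along \<open>\<nu>\<close>.\<close>

definition C2_boundary :: "'a::euclidean_space set \<Rightarrow> bool" where
  "C2_boundary \<Omega> \<longleftrightarrow>
    (\<forall>z\<in>frontier \<Omega>. \<exists>\<nu> r \<gamma>.
      norm \<nu> = 1 \<and> r > 0 \<and> C2_on \<gamma> UNIV \<and> (\<forall>x s. \<gamma> (x + s *\<^sub>R \<nu>) = \<gamma> x) \<and>
      \<Omega> \<inter> ball z r = {x \<in> ball z r. \<gamma> x < x \<bullet> \<nu>})"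

definition bounded_C2_domain :: "'a::euclidean_space set \<Rightarrow> bool" where
  "bounded_C2_domain \<Omega> \<longleftrightarrow>
    open \<Omega> \<and> connected \<Omega> \<and> \<Omega> \<noteq> {} \<and> bounded \<Omega> \<and> C2_boundary \<Omega>"

definition boundary_dist :: "'a::euclidean_space set \<Rightarrow> 'a \<Rightarrow> real" where
  "boundary_dist \<Omega> x = infdist x (frontier \<Omega>)"

definition sym_mats :: "(real ^ 'n ^ 'n) set" where
  "sym_mats = {X. transpose X = X}"

text \<open>The usual partial order on symmetric matrices: \<open>Y - X\<close> is positive semidefinite.\<close>

definition mat_le :: "real ^ 'n ^ 'n \<Rightarrow> real ^ 'n ^ 'n \<Rightarrow> bool" (infix \<open>\<preceq>\<close> 50) where
  "X \<preceq> Y \<longleftrightarrow> (\<forall>v. v \<bullet> (X *v v) \<le> v \<bullet> (Y *v v))"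

text \<open>The \<open>2n \<times> 2n\<close> matrix with blocks \<open>P\<close>, \<open>Q\<close> in the first and \<open>R\<close>, \<open>S\<close> in the second
  row; its index type is \<open>'n + 'n\<close>.\<close>

definition block_mat ::
  "real ^ 'n ^ 'n \<Rightarrow> real ^ 'n ^ 'n \<Rightarrow> real ^ 'n ^ 'n \<Rightarrow> real ^ 'n ^ 'n
    \<Rightarrow> real ^ ('n + 'n) ^ ('n + 'n)" where
  "block_mat P Q R S =
    (\<chi> i j. case (i, j) of
        (Inl a, Inl b) \<Rightarrow> P $ a $ b
      | (Inl a, Inr b) \<Rightarrow> Q $ a $ b
      | (Inr a, Inl b) \<Rightarrow> R $ a $ b
      | (Inr a, Inr b) \<Rightarrow> S $ a $ b)"

definition modulus_of_continuity :: "(real \<Rightarrow> real) \<Rightarrow> bool" where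
  "modulus_of_continuity \<omega> \<longleftrightarrow>
    (\<forall>s\<ge>0. 0 \<le> \<omega> s) \<and> mono_on {0..} \<omega> \<and> continuous_on {0..} \<omega> \<and> \<omega> 0 = 0"

definition locally_bounded_on :: "'a::metric_space set \<Rightarrow> ('a \<Rightarrow> real) \<Rightarrow> bool" where
  "locally_bounded_on S u \<longleftrightarrow> (\<forall>z\<in>S. \<exists>r>0. bounded (u ` (S \<inter> ball z r)))"

definition usc_on :: "'a::metric_space set \<Rightarrow> ('a \<Rightarrow> real) \<Rightarrow> bool" where
  "usc_on S u \<longleftrightarrow> (\<forall>z\<in>S. \<forall>c>u z. \<forall>\<^sub>F w in at z within S. u w < c)"

definition lsc_on :: "'a::metric_space set \<Rightarrow> ('a \<Rightarrow> real) \<Rightarrow> bool" where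
  "lsc_on S u \<longleftrightarrow> (\<forall>z\<in>S. \<forall>c<u z. \<forall>\<^sub>F w in at z within S. c < u w)"

definition local_max_at :: "'a::metric_space set \<Rightarrow> ('a \<Rightarrow> real) \<Rightarrow> 'a \<Rightarrow> bool" where
  "local_max_at S f z \<longleftrightarrow> z \<in> S \<and> (\<exists>r>0. \<forall>w\<in>S \<inter> ball z r. f w \<le> f z)"

definition local_min_at :: "'a::metric_space set \<Rightarrow> ('a \<Rightarrow> real) \<Rightarrow> 'a \<Rightarrow> bool" where
  "local_min_at S f z \<longleftrightarrow> z \<in> S \<and> (\<exists>r>0. \<forall>w\<in>S \<inter> ball z r. f z \<le> f w)"

text \<open>The notions below refer to the equation \<open>u\<^sub>t + u + F(x, \<nabla>u, \<nabla>\<^sup>2u) = 0\<close> in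
  \<open>\<Omega> \<times> (0, T)\<close>.  Functions of space and time are functions of the pair \<open>(x, t)\<close>; \<open>\<nabla>\<close> and
  \<open>\<nabla>\<^sup>2\<close> act on the space variable only.\<close>

definition parabolic_op ::
  "(real ^ 'n \<Rightarrow> real ^ 'n \<Rightarrow> real ^ 'n ^ 'n \<Rightarrow> real) \<Rightarrow> ((real ^ 'n) \<times> real \<Rightarrow> real)
    \<Rightarrow> ((real ^ 'n) \<times> real \<Rightarrow> real) \<Rightarrow> real ^ 'n \<Rightarrow> real \<Rightarrow> real" where
  "parabolic_op F u \<phi> x t =
    deriv (\<lambda>s. \<phi> (x, s)) t + u (x, t)
      + F x (gradient (\<lambda>y. \<phi> (y, t)) x) (hessian (\<lambda>y. \<phi> (y, t)) x)"

definition viscosity_subsolution ::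
  "(real ^ 'n) set \<Rightarrow> real \<Rightarrow> (real ^ 'n \<Rightarrow> real ^ 'n \<Rightarrow> real ^ 'n ^ 'n \<Rightarrow> real)
    \<Rightarrow> ((real ^ 'n) \<times> real \<Rightarrow> real) \<Rightarrow> bool" where
  "viscosity_subsolution \<Omega> T F u \<longleftrightarrow>
    locally_bounded_on (\<Omega> \<times> {0<..<T}) u \<and> usc_on (\<Omega> \<times> {0<..<T}) u \<and>
    (\<forall>x t \<phi>. C2_on \<phi> (\<Omega> \<times> {0<..<T}) \<longrightarrow>
      local_max_at (\<Omega> \<times> {0<..<T}) (\<lambda>z. u z - \<phi> z) (x, t) \<longrightarrow>
      parabolic_op F u \<phi> x t \<le> 0)"

definition viscosity_supersolution ::
  "(real ^ 'n) set \<Rightarrow> real \<Rightarrow> (real ^ 'n \<Rightarrow> real ^ 'n \<Rightarrow> real ^ 'n ^ 'n \<Rightarrow> real)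
    \<Rightarrow> ((real ^ 'n) \<times> real \<Rightarrow> real) \<Rightarrow> bool" where
  "viscosity_supersolution \<Omega> T F u \<longleftrightarrow>
    locally_bounded_on (\<Omega> \<times> {0<..<T}) u \<and> lsc_on (\<Omega> \<times> {0<..<T}) u \<and>
    (\<forall>x t \<phi>. C2_on \<phi> (\<Omega> \<times> {0<..<T}) \<longrightarrow>
      local_min_at (\<Omega> \<times> {0<..<T}) (\<lambda>z. u z - \<phi> z) (x, t) \<longrightarrow>
      0 \<le> parabolic_op F u \<phi> x t)"

definition viscosity_solution ::
  "(real ^ 'n) set \<Rightarrow> real \<Rightarrow> (real ^ 'n \<Rightarrow> real ^ 'n \<Rightarrow> real ^ 'n ^ 'n \<Rightarrow> real)
    \<Rightarrow> ((real ^ 'n) \<times> real \<Rightarrow> real) \<Rightarrow> bool" where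
  "viscosity_solution \<Omega> T F u \<longleftrightarrow>
    continuous_on (\<Omega> \<times> {0<..<T}) u \<and>
    viscosity_subsolution \<Omega> T F u \<and> viscosity_supersolution \<Omega> T F u"

end

theory Submission
  imports Defs
begin

text \<open>
  Write \<open>d\<close> for the distance to the boundary. The function \<open>g = ln (ln (1 / d))\<close> blows up at the
  boundary but oscillates only by \<open>\<omega>(d) = C / ln (1 / d)\<close> on balls of radius \<open>d / 2\<close>. For a maximum point
  \<open>(x, z, t)\<close> of \<open>u(x, t) - \<eta> (g(z) + \<omega>(d(z)) \<bar>x - z\<bar>\<^sup>2 / d(z)\<^sup>2) - \<epsilon> / (T - t)\<close> subject to
  \<open>\<bar>x - z\<bar> \<le> d(z) / 2\<close>, comparison with \<open>z = x\<close> shows \<open>d(x) \<le> d(z)\<close> and that the constraint is not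
  active. Hence a quadratic polynomial in \<open>x\<close> is an admissible test function, with gradient and Hessian
  of size \<open>\<eta> \<omega>(d(z)) / d(z)\<close> and \<open>\<eta> \<omega>(d(z)) / d(z)\<^sup>2\<close>. On these \<open>F\<close> is uniformly small as \<open>\<eta> \<rightarrow> 0\<close>, by
  hypothesis (iii) near the boundary and (iv) away from it, so \<open>u(x, t) \<le> \<epsilon>\<close> at the maximum
  if \<open>t > 0\<close>; for \<open>t = 0\<close> the initial condition applies. Letting \<open>\<eta>\<close> and then \<open>\<epsilon>\<close> tend to \<open>0\<close> yields
  \<open>u \<le> 0\<close>, and \<open>u \<ge> 0\<close> is symmetric.
\<close>

section \<open>Gradients and Hessians from explicit derivatives\<close>

lemma GDERIV_unique:
  assumes "GDERIV f x :> D" "GDERIV f x :> E"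
  shows "D = E"
proof -
  have "(\<lambda>h. h \<bullet> D) = (\<lambda>h. h \<bullet> E)"
    using assms has_derivative_unique unfolding gderiv_def by blast
  then show ?thesis
    by (metis inner_commute vector_eq_rdot)
qed

lemma gradient_eqI: "GDERIV f x :> D \<Longrightarrow> gradient f x = D"
  unfolding gradient_def using GDERIV_unique by blast

text \<open>\<open>gradient\<close> is a definite description, so it is replaced by \<open>g\<close>
  on a whole neighbourhood of \<open>x\<close> before differentiating once more.\<close>

lemma hessian_eqI:
  fixes f :: "real ^ 'n \<Rightarrow> real"
  assumes "open S" "x \<in> S" and grad: "\<And>z. z \<in> S \<Longrightarrow> GDERIV f z :> g z"
    and g: "(g has_derivative g') (at x)"
  shows "hessian f x = matrix g'"
proof -
  have "(gradient f has_derivative g') (at x)"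
    using has_derivative_transform_within_open[OF g assms(1,2)] gradient_eqI[OF grad] by auto
  then show ?thesis
    unfolding hessian_def jacobian_def using frechet_derivative_at by metis
qed

lemma local_min_at_uminus: "local_max_at S f z \<Longrightarrow> local_min_at S (\<lambda>z. - f z) z"
  by (simp add: local_max_at_def local_min_at_def)

section \<open>Quadratic test functions with a singularity at the final time\<close>

lemma deriv_time_penalty:
  assumes "t < T"
  shows "((\<lambda>s. \<epsilon> / (T - s)) has_real_derivative \<epsilon> / (T - t)\<^sup>2) (at t)"
    and "((\<lambda>s. \<epsilon> / (T - s)\<^sup>2) has_real_derivative 2 * \<epsilon> / (T - t) ^ 3) (at t)"
  using assms by (auto intro!: derivative_eq_intros simp: divide_simps power2_eq_square eval_nat_numeral)
    (simp add: algebra_simps)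

text \<open>Both coefficients may have either sign, so the negative of a test function for the upper
  bound serves the lower bound. For \<epsilon> > 0 the time term keeps maximum points away from
  \<open>T\<close> and has a nonnegative time derivative.\<close>

definition quad_test :: "real \<Rightarrow> 'a::real_inner \<Rightarrow> real \<Rightarrow> real \<Rightarrow> 'a \<times> real \<Rightarrow> real" where
  "quad_test c z \<epsilon> T = (\<lambda>(x, t). c * ((x - z) \<bullet> (x - z)) + \<epsilon> / (T - t))"

lemma quad_test_uminus: "quad_test (- c) z (- \<epsilon>) T w = - quad_test c z \<epsilon> T w"
  by (simp add: quad_test_def case_prod_unfold)

lemma C2_on_quad_test:
  fixes z :: "'a::euclidean_space"
  shows "C2_on (quad_test c z \<epsilon> T) (S \<times> {0<..<T})"
proof -
  define g where "g = (\<lambda>w :: 'a \<times> real. ((2 * c) *\<^sub>R (fst w - z), \<epsilon> / (T - snd w)\<^sup>2))"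
  define h where "h = (\<lambda>(w :: 'a \<times> real) (v :: 'a \<times> real). ((2 * c) *\<^sub>R fst v, (2 * \<epsilon> / (T - snd w) ^ 3) * snd v))"
  have lin: "linear (h w)" for w :: "'a \<times> real"
    unfolding h_def by (rule linearI) (simp_all add: algebra_simps add_divide_distrib)
  \<comment> \<open>\<open>C2_on\<close> asks for a second derivative with values in the bounded
    linear maps on space-time, so the pointwise formula \<open>h\<close> is bundled.\<close>
  define H where "H w = Blinfun (h w)" for w
  have H: "blinfun_apply (H w) = h w" for w
    unfolding H_def
    by (rule bounded_linear_Blinfun_apply) (simp add: lin linear_conv_bounded_linear[symmetric])
  have time: "((\<lambda>w. f (snd w)) has_derivative (\<lambda>v. f' * snd v)) (at w)"
    if "(f has_real_derivative f') (at (snd w))" for f f' and w :: "'a \<times> real"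
    using has_derivative_compose[OF has_derivative_snd[OF has_derivative_ident]
        that[unfolded has_field_derivative_def]] .
  have 1: "GDERIV (quad_test c z \<epsilon> T) w :> g w" if "w \<in> S \<times> {0<..<T}" for w
  proof -
    have "snd w < T" using that by auto
    note A = time[OF deriv_time_penalty(1)[OF this, of \<epsilon>]]
    have B: "((\<lambda>w. c * ((fst w - z) \<bullet> (fst w - z))) has_derivative
        (\<lambda>v. fst v \<bullet> ((2 * c) *\<^sub>R (fst w - z)))) (at w)"
      by (auto intro!: derivative_eq_intros simp: inner_commute)
    show ?thesis
      using has_derivative_add[OF B A]
      by (simp add: gderiv_def quad_test_def g_def case_prod_unfold inner_prod_def mult_ac)
  qed
  have 2: "(g has_derivative H w) (at w)" if "w \<in> S \<times> {0<..<T}" for w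
  proof -
    have "snd w < T" using that by auto
    note A = time[OF deriv_time_penalty(2)[OF this, of \<epsilon>]]
    have B: "((\<lambda>w. (2 * c) *\<^sub>R (fst w - z)) has_derivative (\<lambda>v. (2 * c) *\<^sub>R fst v)) (at w)"
      by (auto intro!: derivative_eq_intros)
    show ?thesis
      using has_derivative_Pair[OF B A] by (simp add: H h_def g_def)
  qed
  \<comment> \<open>In finite dimension, continuity in operator norm follows from continuity of the
    values at basis vectors.\<close>
  have "continuous_on (S \<times> {0<..<T}) (\<lambda>w. h w i)" for i
    unfolding h_def by (intro continuous_intros) auto
  then have "continuous_on (S \<times> {0<..<T}) H"
    by (intro continuous_on_blinfun_componentwise) (simp add: H)
  with 1 2 show ?thesis unfolding C2_on_def by blast
qed

lemma parabolic_op_quad_test: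
  assumes "t < T"
  shows "parabolic_op F u (quad_test c z \<epsilon> T) x t =
    \<epsilon> / (T - t)\<^sup>2 + u (x, t) + F x ((2 * c) *\<^sub>R (x - z)) ((2 * c) *\<^sub>R mat 1)"
proof -
  have "((\<lambda>s. quad_test c z \<epsilon> T (x, s)) has_real_derivative \<epsilon> / (T - t)\<^sup>2) (at t)"
    unfolding quad_test_def
    using DERIV_add[OF DERIV_const deriv_time_penalty(1)[OF assms]] by simp
  then have time: "deriv (\<lambda>s. quad_test c z \<epsilon> T (x, s)) t = \<epsilon> / (T - t)\<^sup>2"
    by (rule DERIV_imp_deriv)
  have G: "GDERIV (\<lambda>x. quad_test c z \<epsilon> T (x, t)) y :> (2 * c) *\<^sub>R (y - z)" for y
    unfolding quad_test_def gderiv_def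
    by (auto intro!: derivative_eq_intros simp: inner_commute)
  have "((\<lambda>y. (2 * c) *\<^sub>R (y - z)) has_derivative (\<lambda>v. (2 * c) *\<^sub>R v)) (at x)"
    by (auto intro!: derivative_eq_intros)
  from hessian_eqI[OF open_UNIV UNIV_I G this]
  have hess: "hessian (\<lambda>x. quad_test c z \<epsilon> T (x, t)) x = (2 * c) *\<^sub>R mat 1"
    by (simp add: matrix_def mat_def vec_eq_iff axis_def)
  show ?thesis unfolding parabolic_op_def time hess gradient_eqI[OF G] ..
qed

text \<open>The matrix norm is Euclidean in the entries, so the identity does not have norm 1 in
  general. The bound is cruder than the exact square root of n, which only affects a
  constant.\<close>

lemma norm_mat_1_le: "norm (mat 1 :: real ^ 'n ^ 'n) \<le> CARD('n)"
proof -
  have "(mat 1 :: real ^ 'n ^ 'n) $ i = axis i 1" for i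
    by (simp add: mat_def axis_def vec_eq_iff)
  then have "(\<Sum>i\<in>UNIV. norm ((mat 1 :: real ^ 'n ^ 'n) $ i)) = CARD('n)"
    by (simp add: norm_axis_1)
  moreover have "norm (mat 1 :: real ^ 'n ^ 'n) \<le> (\<Sum>i\<in>UNIV. norm ((mat 1 :: real ^ 'n ^ 'n) $ i))"
    unfolding norm_vec_def by (rule L2_set_le_sum) auto
  ultimately show ?thesis by simp
qed

section \<open>A logarithmic modulus of continuity and the matching penalty\<close>

text \<open>For 0 < r <= R this is C / (1 + ln (R / r)). The cap \<open>min r R\<close> continues it
  by the constant \<open>C\<close>, which keeps the denominator at least 1 and the function
  increasing on the whole half-line. The value at 0 is the limit there.\<close>

definition log_modulus :: "real \<Rightarrow> real \<Rightarrow> real \<Rightarrow> real" where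
  "log_modulus C R r = (if r = 0 then 0 else C / (1 + ln R - ln (min r R)))"

lemma modulus_of_continuity_log_modulus:
  assumes "R > 0" "C \<ge> 0"
  shows "modulus_of_continuity (log_modulus C R)"
proof -
  define a where "a = 1 + ln R"
  have pos: "a - ln (min r R) \<ge> 1" if "r > 0" for r
    using that assms by (simp add: a_def min_def)
  have nonneg: "log_modulus C R r \<ge> 0" if "r \<ge> 0" for r
  proof (cases "r = 0")
    case False
    then have "a - ln (min r R) > 0" using pos[of r] that by simp
    then show ?thesis using False assms
      by (simp add: log_modulus_def a_def[symmetric] del: diff_gt_0_iff_gt)
  qed (simp add: log_modulus_def)
  have mono: "log_modulus C R r \<le> log_modulus C R s" if "0 \<le> r" "r \<le> s" for r s
  proof (cases "r = 0")
    case True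
    then show ?thesis using nonneg[of s] that by (simp add: log_modulus_def)
  next
    case False
    with that have "0 < r" "0 < s" by auto
    have "ln (min r R) \<le> ln (min s R)"
      using assms that \<open>0 < r\<close> by (intro ln_mono) auto
    then have "C / (a - ln (min r R)) \<le> C / (a - ln (min s R))"
      using pos[OF \<open>0 < r\<close>] pos[OF \<open>0 < s\<close>] assms
      by (intro divide_left_mono mult_pos_pos) linarith+
    then show ?thesis
      using \<open>0 < r\<close> \<open>0 < s\<close> by (simp add: log_modulus_def a_def)
  qed
  have cont0: "(log_modulus C R \<longlongrightarrow> 0) (at 0 within {0..})"
  proof -
    have "filterlim (\<lambda>r :: real. - ln r) at_top (at_right 0)"
      using ln_at_0 by (simp add: filterlim_uminus_at_bot)
    then have "filterlim (\<lambda>r. a + - ln r) at_top (at_right 0)"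
      by (rule filterlim_tendsto_add_at_top[OF tendsto_const])
    then have "((\<lambda>r. C / (a + - ln r)) \<longlongrightarrow> 0) (at_right 0)"
      by (intro tendsto_divide_0[OF tendsto_const] filterlim_at_top_imp_at_infinity)
    \<comment> \<open>The cap is inactive below \<open>R\<close>.\<close>
    moreover have "\<forall>\<^sub>F r in at_right 0. C / (a + - ln r) = log_modulus C R r"
      unfolding eventually_at_right_field using assms
      by (intro exI[of _ R]) (auto simp: log_modulus_def a_def min_def)
    ultimately show ?thesis
      unfolding at_within_Ici_at_right by (rule Lim_transform_eventually)
  qed
  have "continuous_on {0<..} (\<lambda>r. C / (a - ln (min r R)))"
  proof (intro continuous_intros ballI)
    show "min r R \<noteq> 0" if "r \<in> {0<..}" for r using that assms by (auto simp: min_def)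
    show "a - ln (min r R) \<noteq> 0" if "r \<in> {0<..}" for r
      using pos[of r] that by (metis greaterThan_iff not_one_le_zero)
  qed
  then have "continuous_on {0<..} (log_modulus C R)"
    by (rule continuous_on_cong[THEN iffD1, rotated 2]) (auto simp: log_modulus_def a_def)
  then have contpos: "isCont (log_modulus C R) r" if "r > 0" for r
    using that continuous_on_eq_continuous_at[OF open_greaterThan] by blast
  have "continuous (at r within {0..}) (log_modulus C R)" if "r \<in> {0..}" for r
  proof (cases "r = 0")
    case True
    then show ?thesis using cont0 by (simp add: continuous_within log_modulus_def)
  next
    case False
    then show ?thesis using contpos[of r] that by (simp add: continuous_at_imp_continuous_at_within)
  qed
  then have "continuous_on {0..} (log_modulus C R)"
    by (simp add: continuous_on_eq_continuous_within)
  then show ?thesis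
    using nonneg mono
    unfolding modulus_of_continuity_def by (auto intro!: mono_onI simp: log_modulus_def)
qed

text \<open>The constant 4 makes the constraint \<open>\<bar>x - z\<bar> \<le> d(z) / 2\<close> inactive: moving \<open>z\<close> to \<open>x\<close> raises \<open>g\<close> by
  at most \<open>ln 2 / L\<close> with \<open>L = 1 + ln R - ln (d(z))\<close>, but the quadratic term is \<open>1 / L\<close> on the constraint.\<close>

definition penalty :: "real \<Rightarrow> real \<Rightarrow> real" where
  "penalty R r = 4 / ((1 + ln R - ln r) * r\<^sup>2)"

lemma log_ge_1: "0 < r \<Longrightarrow> r \<le> R \<Longrightarrow> 1 + ln R - ln r \<ge> (1 :: real)"
  using ln_mono[of r R] by linarith

lemma penalty_pos: "0 < r \<Longrightarrow> r \<le> R \<Longrightarrow> penalty R r > 0"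
  using less_le_trans[OF zero_less_one log_ge_1] unfolding penalty_def
  by (intro divide_pos_pos mult_pos_pos) auto

section \<open>Uniform smallness of the operator on the test functions\<close>

text \<open>The order of choices gives uniformity in \<open>x\<close> and \<open>z\<close>: the
  modulus does not depend on \<eta>, so the width \<delta> of the boundary layer is fixed first, and
  only then is the threshold for \<eta> adapted to the remaining region. Both signs of \<eta> are
  covered, for the upper and the lower bound.\<close>

lemma operator_small_on_quad_test:
  fixes F :: "real ^ 'n \<Rightarrow> real ^ 'n \<Rightarrow> real ^ 'n ^ 'n \<Rightarrow> real"
  assumes boundary: "\<And>\<omega>. modulus_of_continuity \<omega> \<Longrightarrow>
      ((\<lambda>\<delta>. SUP (x, p, X) \<in> {(x, p, X). x \<in> \<Omega> \<and> X \<in> sym_mats \<and> d x \<le> \<delta> \<and>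
                norm p \<le> \<omega> \<delta> / \<delta> \<and> norm X \<le> \<omega> \<delta> / \<delta>\<^sup>2}. ereal \<bar>F x p X\<bar>)
        \<longlongrightarrow> 0) (at_right 0)"
    and interior: "((\<lambda>(p, X). SUP x\<in>\<Omega>. ereal \<bar>F x p X\<bar>) \<longlongrightarrow> 0)
        (at (0, 0) within UNIV \<times> sym_mats)"
    and R: "R > 0" and \<epsilon>: "\<epsilon> > 0"
  obtains \<eta>\<^sub>0 where "\<eta>\<^sub>0 > 0"
    "\<And>\<eta> x z. \<lbrakk>\<eta> \<noteq> 0; \<bar>\<eta>\<bar> \<le> \<eta>\<^sub>0; x \<in> \<Omega>; 0 < d z; d z \<le> R; d x \<le> d z; norm (x - z) \<le> d z / 2\<rbrakk> \<Longrightarrow>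
      \<bar>F x ((2 * (\<eta> * penalty R (d z))) *\<^sub>R (x - z)) ((2 * (\<eta> * penalty R (d z))) *\<^sub>R mat 1)\<bar> < \<epsilon>"
proof -
  \<comment> \<open>The 8 is the 4 of \<open>penalty\<close> times the 2 from differentiating the
    square; the dimension bounds the norm of the identity.\<close>
  define C where "C = 8 * real CARD('n)"
  have C: "C \<ge> 8" by (simp add: C_def Suc_le_eq)
  define \<omega> where "\<omega> = log_modulus C R"
  have mod: "modulus_of_continuity \<omega>"
    unfolding \<omega>_def using R C by (intro modulus_of_continuity_log_modulus) auto
  have \<epsilon>': "0 < ereal \<epsilon>" using \<epsilon> by simp
  obtain \<delta> where \<delta>: "\<delta> > 0" "\<And>r. 0 < r \<Longrightarrow> r < \<delta> \<Longrightarrow>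
    (SUP (x, p, X) \<in> {(x, p, X). x \<in> \<Omega> \<and> X \<in> sym_mats \<and> d x \<le> r \<and>
                norm p \<le> \<omega> r / r \<and> norm X \<le> \<omega> r / r\<^sup>2}. ereal \<bar>F x p X\<bar>) < ereal \<epsilon>"
    using order_tendstoD(2)[OF boundary[OF mod] \<epsilon>'] unfolding eventually_at_right_field by auto
  obtain \<rho> where \<rho>: "\<rho> > 0" "\<And>p X. X \<in> sym_mats \<Longrightarrow> (p, X) \<noteq> (0, 0) \<Longrightarrow> norm (p, X) < \<rho> \<Longrightarrow>
    (SUP x\<in>\<Omega>. ereal \<bar>F x p X\<bar>) < ereal \<epsilon>"
    using order_tendstoD(2)[OF interior \<epsilon>'] unfolding eventually_at
    by (auto simp: dist_norm simp flip: zero_prod_def)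
  \<comment> \<open>Since \<omega> <= C, this bounds the sum of the gradient and Hessian bounds,
    apart from the factor \<eta>, wherever r >= \<delta>.\<close>
  define Q where "Q = C / \<delta> + C / \<delta>\<^sup>2"
  have Q: "Q > 0" using C \<delta>(1) by (simp add: Q_def add_pos_pos)
  \<comment> \<open>The 1 allows the factor \<eta> to be dropped inside the boundary layer; the
    other term, halved for strictness, serves the region outside it.\<close>
  define \<eta>\<^sub>0 where "\<eta>\<^sub>0 = min 1 (\<rho> / (2 * Q))"
  have \<eta>\<^sub>0: "\<eta>\<^sub>0 > 0" "\<eta>\<^sub>0 \<le> 1" "\<eta>\<^sub>0 * Q < \<rho>"
  proof -
    have "\<eta>\<^sub>0 * Q \<le> \<rho> / (2 * Q) * Q" using Q by (intro mult_right_mono) (auto simp: \<eta>\<^sub>0_def)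
    then show "\<eta>\<^sub>0 * Q < \<rho>" using Q \<rho>(1) by simp
  qed (use Q \<rho> in \<open>auto simp: \<eta>\<^sub>0_def\<close>)
  show thesis
  proof (rule that[OF \<eta>\<^sub>0(1)])
    fix \<eta> x z
    assume \<eta>: "\<eta> \<noteq> 0" "\<bar>\<eta>\<bar> \<le> \<eta>\<^sub>0" and x: "x \<in> \<Omega>" "0 < d z" "d z \<le> R" "d x \<le> d z" "norm (x - z) \<le> d z / 2"
    define p X where "p = (2 * (\<eta> * penalty R (d z))) *\<^sub>R (x - z)"
      and "X = (2 * (\<eta> * penalty R (d z))) *\<^sub>R (mat 1 :: real ^ 'n ^ 'n)"
    define r L where "r = d z" and "L = 1 + ln R - ln r"
    have r: "0 < r" "r \<le> R" and L: "L \<ge> 1"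
      using x log_ge_1[of r R] by (simp_all add: r_def L_def)
    have pen: "penalty R (d z) = 4 / (L * r\<^sup>2)" by (simp add: penalty_def L_def r_def)
    have \<omega>: "\<omega> r = C / L" using r by (simp add: \<omega>_def log_modulus_def L_def)
    have \<omega>_bounds: "0 \<le> \<omega> r" "\<omega> r \<le> C"
      using L C frac_le[of C C 1 L] by (auto simp: \<omega>)
    have sym: "X \<in> sym_mats"
      by (simp add: X_def sym_mats_def transpose_def mat_def vec_eq_iff)
    have "norm p = \<bar>\<eta>\<bar> * (8 / (L * r\<^sup>2)) * norm (x - z)"
      using L by (simp add: p_def pen abs_mult)
    \<comment> \<open>The constraint on \<open>x - z\<close> gains one power of \<open>r\<close>,
      which gives the gradient scaling of hypothesis (iii).\<close>
    also have "\<dots> \<le> \<bar>\<eta>\<bar> * (8 / (L * r\<^sup>2)) * (r / 2)"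
      using x L by (intro mult_left_mono) (auto simp: r_def)
    also have "\<dots> = \<bar>\<eta>\<bar> * (4 / L / r)"
      using r by (simp add: power2_eq_square)
    also have "\<dots> \<le> \<bar>\<eta>\<bar> * (\<omega> r / r)"
      unfolding \<omega> using r L C by (intro mult_left_mono divide_right_mono) auto
    finally have p: "norm p \<le> \<bar>\<eta>\<bar> * (\<omega> r / r)" .
    have "norm X = \<bar>\<eta>\<bar> * (8 / (L * r\<^sup>2)) * norm (mat 1 :: real ^ 'n ^ 'n)"
      using L by (simp add: X_def pen abs_mult)
    also have "\<dots> \<le> \<bar>\<eta>\<bar> * (8 / (L * r\<^sup>2)) * CARD('n)"
      using L by (intro mult_left_mono norm_mat_1_le) auto
    also have "\<dots> = \<bar>\<eta>\<bar> * (\<omega> r / r\<^sup>2)"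
      by (simp add: \<omega> C_def)
    finally have X: "norm X \<le> \<bar>\<eta>\<bar> * (\<omega> r / r\<^sup>2)" .
    have "\<bar>F x p X\<bar> < \<epsilon>"
    proof (cases "r < \<delta>")
      case True
      have "norm p \<le> 1 * (\<omega> r / r)" "norm X \<le> 1 * (\<omega> r / r\<^sup>2)"
        using \<omega>_bounds r \<eta> \<eta>\<^sub>0 by (intro order_trans[OF p] order_trans[OF X] mult_right_mono; simp)+
      \<comment> \<open>Hypothesis (iii) is applied at scale \<open>d z\<close>, although
        \<open>F\<close> is evaluated at \<open>x\<close>; this is where
        \<open>d x \<le> d z\<close> enters.\<close>
      then have "ereal \<bar>F x p X\<bar> \<le> (SUP (x', p, X) \<in> {(x', p, X). x' \<in> \<Omega> \<and> X \<in> sym_mats \<and>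
          d x' \<le> r \<and> norm p \<le> \<omega> r / r \<and> norm X \<le> \<omega> r / r\<^sup>2}. ereal \<bar>F x' p X\<bar>)"
        using x sym by (intro SUP_upper2[of "(x, p, X)"]) (auto simp: r_def)
      also have "\<dots> < ereal \<epsilon>" by (rule \<delta>(2)[OF r(1) True])
      finally show ?thesis by simp
    next
      case False
      have "norm (p, X) \<le> norm p + norm X"
        by (simp add: norm_Pair order_trans[OF sqrt_add_le_add_sqrt])
      also have "\<dots> \<le> \<bar>\<eta>\<bar> * (\<omega> r / r + \<omega> r / r\<^sup>2)"
        using p X by (simp add: distrib_left)
      also have "\<dots> \<le> \<bar>\<eta>\<bar> * Q"
        unfolding Q_def using False \<omega>_bounds \<delta>(1) r C
        by (intro mult_left_mono add_mono frac_le power_mono) auto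
      also have "\<dots> \<le> \<eta>\<^sub>0 * Q" using \<eta> Q by (intro mult_right_mono) auto
      also have "\<dots> < \<rho>" by (rule \<eta>\<^sub>0)
      finally have small: "norm (p, X) < \<rho>" .
      \<comment> \<open>The limit in (iv) is punctured and says nothing at (0, 0). As
        \<open>p\<close> vanishes when x = z, the nonzero Hessian has to exclude that point.\<close>
      have "X $ i $ i \<noteq> 0" for i
        using \<eta> penalty_pos[OF x(2,3)] by (simp add: X_def mat_def)
      then have "X \<noteq> 0" by (metis zero_index)
      then have "(SUP x\<in>\<Omega>. ereal \<bar>F x p X\<bar>) < ereal \<epsilon>" by (intro \<rho>(2)[OF sym _ small]) simp
      moreover have "ereal \<bar>F x p X\<bar> \<le> (SUP x\<in>\<Omega>. ereal \<bar>F x p X\<bar>)"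
        using x by (intro SUP_upper) auto
      ultimately have "ereal \<bar>F x p X\<bar> < ereal \<epsilon>" by (rule le_less_trans[rotated])
      then show ?thesis by simp
    qed
    then show "\<bar>F x ((2 * (\<eta> * penalty R (d z))) *\<^sub>R (x - z)) ((2 * (\<eta> * penalty R (d z))) *\<^sub>R mat 1)\<bar> < \<epsilon>"
      by (simp add: p_def X_def)
  qed
qed

section \<open>Maximum points of the penalized function\<close>

text \<open>The equation enters only through \<open>touch\<close>, so the same argument applies to
  \<open>u\<close> and to \<open>- u\<close>. Doubling the space variable freezes the distance at
  \<open>z\<close>, so \<open>d\<close> is never differentiated. The error terms are the penalties
  at the diagonal point (x, x, t).\<close>

lemma penalized_doubling_bound:
  fixes \<Omega> :: "(real ^ 'n) set" and v :: "(real ^ 'n) \<times> real \<Rightarrow> real"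
  defines "d \<equiv> boundary_dist \<Omega>"
  assumes "open \<Omega>" "bounded \<Omega>"
    and d_pos: "\<And>x. x \<in> \<Omega> \<Longrightarrow> d x > 0" and d_le: "\<And>x. x \<in> \<Omega> \<Longrightarrow> d x \<le> R"
    and v_cont: "continuous_on (\<Omega> \<times> {0..<T}) v"
    and v_le: "\<And>w. w \<in> \<Omega> \<times> {0..<T} \<Longrightarrow> v w \<le> B"
    and v_init: "\<And>x. x \<in> \<Omega> \<Longrightarrow> v (x, 0) \<le> 0"
    and \<eta>: "\<eta> > 0" and \<epsilon>: "\<epsilon> > 0"
    and touch: "\<And>x z t. \<lbrakk>x \<in> \<Omega>; z \<in> \<Omega>; t \<in> {0<..<T}; d x \<le> d z; norm (x - z) \<le> d z / 2;
        local_max_at (\<Omega> \<times> {0<..<T}) (\<lambda>w. v w - quad_test (\<eta> * penalty R (d z)) z \<epsilon> T w) (x, t)\<rbrakk>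
      \<Longrightarrow> v (x, t) \<le> \<epsilon>"
    and x: "x \<in> \<Omega>" and t: "0 \<le> t" "t < T"
  shows "v (x, t) \<le> \<epsilon> + \<eta> * ln (1 + ln R - ln (d x)) + \<epsilon> / (T - t)"
proof -
  define L where "L z = 1 + ln R - ln (d z)" for z
  have L: "L z \<ge> 1" if "z \<in> \<Omega>" for z
    unfolding L_def by (rule log_ge_1[OF d_pos[OF that] d_le[OF that]])
  define c where "c z = penalty R (d z)" for z
  have c: "c z > 0" if "z \<in> \<Omega>" for z
    unfolding c_def by (rule penalty_pos[OF d_pos[OF that] d_le[OF that]])
  have d_cont: "continuous_on S d" for S
    unfolding d_def boundary_dist_def by (intro continuous_intros)
  have d_lip: "d z \<le> d x + norm (x - z)" for x z
    unfolding d_def boundary_dist_def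
    by (metis dist_norm infdist_triangle norm_minus_commute)
  \<comment> \<open>Compactness requires closures in \<open>K\<close> below; a positive distance
    leads back from the closure into the open set.\<close>
  have in_\<Omega>: "x \<in> \<Omega>" if "x \<in> closure \<Omega>" "d x > 0" for x
  proof (rule ccontr)
    assume "x \<notin> \<Omega>"
    then have "x \<in> frontier \<Omega>" using that \<open>open \<Omega>\<close> by (simp add: frontier_def interior_open)
    then show False using that(2) by (simp add: d_def boundary_dist_def)
  qed
  define D where "D = {((x, z), t). x \<in> \<Omega> \<and> z \<in> \<Omega> \<and> norm (x - z) \<le> d z / 2 \<and> 0 \<le> t \<and> t < T}"
  define \<Phi> where "\<Phi> = (\<lambda>((x, z), t). v (x, t) - \<eta> * (ln (L z) + c z * (norm (x - z))\<^sup>2) - \<epsilon> / (T - t))"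
  have nonneg: "0 \<le> \<eta> * ln (L z)" "0 \<le> \<eta> * (c z * (norm (x - z))\<^sup>2)" if "z \<in> \<Omega>" for x z
    using L[OF that] c[OF that] \<eta> by auto
  have time_nonneg: "0 \<le> \<epsilon> / (T - t)" if "t < T" for t
    using that \<epsilon> by simp
  have \<Phi>_le: "\<Phi> ((x, z), t) \<le> v (x, t)" if "z \<in> \<Omega>" "t < T" for x z t
    using nonneg(1)[OF that(1)] nonneg(2)[OF that(1), of x] time_nonneg[OF that(2)] by (simp add: \<Phi>_def distrib_left)
  have start: "((x, x), t) \<in> D" using x t d_pos[OF x] by (simp add: D_def)
  define m where "m = \<Phi> ((x, x), t)"
  have m_le: "m \<le> B"
    using \<Phi>_le[OF x t(2), of x] v_le[of "(x, t)"] x t by (simp add: m_def)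
  \<comment> \<open>Where \<Phi> is at least its value \<open>m\<close> at the given point, the
    penalties add up to at most B - m, hence to less than \<open>M\<close>.\<close>
  define M where "M = B - m + 1"
  have M: "M > 0" using m_le by (simp add: M_def)
  \<comment> \<open>This solves \<eta> ln (1 + ln R - ln r) = M. Likewise T - \<epsilon> / M in
    \<open>K\<close> is the time at which the time penalty equals \<open>M\<close>.\<close>
  define r where "r = exp (1 + ln R - exp (M / \<eta>))"
  have r: "r > 0" by (simp add: r_def)
  define K where "K = {p \<in> closure \<Omega> \<times> closure \<Omega>. r \<le> d (snd p) \<and> norm (fst p - snd p) \<le> d (snd p) / 2}
    \<times> {0..T - \<epsilon> / M}"
  have "compact K"
  proof -
    have "closed {p. r \<le> d (snd p) \<and> norm (fst p - snd p) \<le> d (snd p) / 2}"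
      by (intro closed_Collect_conj closed_Collect_le continuous_intros
          continuous_on_compose2[OF d_cont[of UNIV]]) auto
    moreover have "compact (closure \<Omega> \<times> closure \<Omega>)"
      using \<open>bounded \<Omega>\<close> by (intro compact_Times) (simp_all add: compact_closure)
    ultimately have "compact ((closure \<Omega> \<times> closure \<Omega>) \<inter>
        {p. r \<le> d (snd p) \<and> norm (fst p - snd p) \<le> d (snd p) / 2})"
      by (rule compact_Int_closed[rotated])
    then show ?thesis
      unfolding K_def Collect_conj_eq Collect_mem_eq by (intro compact_Times compact_Icc)
  qed
  have K_sub: "K \<subseteq> D"
  proof
    fix w assume "w \<in> K"
    then obtain x z t where w: "w = ((x, z), t)" and xz: "x \<in> closure \<Omega>" "z \<in> closure \<Omega>" "r \<le> d z"
      "norm (x - z) \<le> d z / 2" and t: "0 \<le> t" "t \<le> T - \<epsilon> / M"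
      by (auto simp: K_def)
    have "d z > 0" using r xz by simp
    \<comment> \<open>As \<open>d\<close> is 1-Lipschitz, the constraint gives d(x) >= d(z) /
      2.\<close>
    moreover from this have "d x > 0" using d_lip[of z x] xz by simp
    moreover have "\<epsilon> / M > 0" using \<epsilon> M by simp
    ultimately show "w \<in> D" using in_\<Omega> xz t by (simp add: D_def w)
  qed
  have in_K: "w \<in> K" if w: "w \<in> D" and "m \<le> \<Phi> w" for w
  proof -
    obtain x z t where xt: "w = ((x, z), t)" "x \<in> \<Omega>" "z \<in> \<Omega>" "norm (x - z) \<le> d z / 2" "0 \<le> t" "t < T"
      using w by (auto simp: D_def)
    have "\<eta> * ln (L z) + \<epsilon> / (T - t) < M"
      using v_le[of "(x, t)"] \<open>m \<le> \<Phi> w\<close> xt nonneg(2)[OF xt(3), of x]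
      by (simp add: \<Phi>_def M_def distrib_left)
    then have bounds: "\<epsilon> / (T - t) < M" "\<eta> * ln (L z) < M"
      using nonneg(1)[OF xt(3)] time_nonneg[OF xt(6)] by linarith+
    have t_le: "t \<le> T - \<epsilon> / M" using M xt bounds(1) by (simp add: field_simps)
    have "ln (L z) < M / \<eta>" using bounds(2) \<eta> by (simp add: field_simps)
    moreover have "L z > 0" using L[OF xt(3)] by simp
    ultimately have "L z < exp (M / \<eta>)" by (metis exp_less_mono exp_ln)
    then have "1 + ln R - exp (M / \<eta>) < ln (d z)" by (simp add: L_def)
    then have "r < d z" unfolding r_def using d_pos[OF xt(3)] by (metis exp_less_mono exp_ln)
    then show ?thesis using t_le xt closure_subset by (auto simp: K_def)
  qed
  have "continuous_on K \<Phi>"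
  proof -
    have K: "fst (fst w) \<in> \<Omega>" "snd (fst w) \<in> \<Omega>" "0 \<le> snd w" "snd w < T" if "w \<in> K" for w
      using that K_sub by (auto simp: D_def)
    have L_cont: "continuous_on \<Omega> L"
      unfolding L_def using d_pos by (intro continuous_intros d_cont) force
    have c_cont: "continuous_on \<Omega> c"
      unfolding c_def penalty_def L_def[symmetric]
    proof (intro continuous_intros L_cont d_cont ballI)
      fix z assume z: "z \<in> \<Omega>"
      show "L z * (d z)\<^sup>2 \<noteq> 0" using L[OF z] d_pos[OF z] by simp
    qed
    have snd_fst: "continuous_on K (\<lambda>w. snd (fst w))" "(\<lambda>w. snd (fst w)) ` K \<subseteq> \<Omega>"
      using K(2) by (auto intro!: continuous_intros)
    note continuous_on_compose2[OF L_cont snd_fst]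
    moreover have "\<forall>w\<in>K. L (snd (fst w)) \<noteq> 0" using L K(2) by force
    moreover note continuous_on_compose2[OF c_cont snd_fst]
    moreover have "(\<lambda>w. (fst (fst w), snd w)) ` K \<subseteq> \<Omega> \<times> {0..<T}"
      using K(1,3,4) by auto
    then have "continuous_on K (\<lambda>w. v (fst (fst w), snd w))"
      by (rule continuous_on_compose2[OF v_cont, rotated]) (intro continuous_intros)
    moreover have "\<forall>w\<in>K. T - snd w \<noteq> 0" using K(4) by fastforce
    ultimately show ?thesis
      unfolding \<Phi>_def case_prod_unfold by (intro continuous_intros)
  qed
  moreover have "((x, x), t) \<in> K" using start by (rule in_K) (simp add: m_def)
  ultimately obtain w where w: "w \<in> K" and max_K: "\<And>w'. w' \<in> K \<Longrightarrow> \<Phi> w' \<le> \<Phi> w"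
    using continuous_attains_sup[OF \<open>compact K\<close>, of \<Phi>] by fast
  obtain x0 z0 t0 where w_eq: "w = ((x0, z0), t0)" by (metis surj_pair)
  with w K_sub have 0: "x0 \<in> \<Omega>" "z0 \<in> \<Omega>" "norm (x0 - z0) \<le> d z0 / 2" "0 \<le> t0" "t0 < T"
    by (auto simp: D_def)
  \<comment> \<open>Points where \<Phi> is below \<open>m\<close> cannot compete, because the point
    defining \<open>m\<close> lies in \<open>K\<close>; so the maximum over \<open>K\<close> is one
    over \<open>D\<close>.\<close>
  have max: "\<Phi> w' \<le> \<Phi> ((x0, z0), t0)" if "w' \<in> D" for w'
  proof (cases "m \<le> \<Phi> w'")
    case True
    then show ?thesis using in_K[OF that] max_K w_eq by blast
  next
    case False
    then show ?thesis using max_K[OF \<open>((x, x), t) \<in> K\<close>] by (simp add: m_def w_eq)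
  qed
  have "\<Phi> ((x0, x0), t0) \<le> \<Phi> ((x0, z0), t0)"
    using 0 d_pos[OF 0(1)] by (intro max) (simp add: D_def)
  then have "\<eta> * (ln (L z0) + c z0 * (norm (x0 - z0))\<^sup>2) \<le> \<eta> * ln (L x0)"
    by (simp add: \<Phi>_def)
  then have cmp: "ln (L z0) + c z0 * (norm (x0 - z0))\<^sup>2 \<le> ln (L x0)"
    using \<eta> by simp
  have "0 \<le> c z0 * (norm (x0 - z0))\<^sup>2" using c[OF 0(2)] by simp
  then have "ln (L z0) \<le> ln (L x0)" using cmp by linarith
  then have "L z0 \<le> L x0" using L[OF 0(1)] L[OF 0(2)] by simp
  then have d_mono: "d x0 \<le> d z0"
    using d_pos[OF 0(1)] d_pos[OF 0(2)] by (simp add: L_def)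
  \<comment> \<open>Equality would give 1 / L(z0) <= ln (L(x0) / L(z0)) <= (L(x0) - L(z0)) / L(z0),
    so \<open>L\<close> would grow by at least 1. But d(x0) >= d(z0) / 2 allows a growth of at most
    ln 2 < 1.\<close>
  have strict: "norm (x0 - z0) < d z0 / 2"
  proof (rule ccontr)
    assume "\<not> norm (x0 - z0) < d z0 / 2"
    then have eq: "norm (x0 - z0) = d z0 / 2" using 0(3) by simp
    have "c z0 * (norm (x0 - z0))\<^sup>2 = 1 / L z0"
      using d_pos[OF 0(2)] L[OF 0(2)]
      by (simp add: eq c_def penalty_def L_def[symmetric] power_divide)
    then have "1 / L z0 \<le> ln (L x0) - ln (L z0)" using cmp by simp
    also have "\<dots> = ln (L x0 / L z0)" using L[OF 0(1)] L[OF 0(2)] by (simp add: ln_div)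
    also have "\<dots> \<le> L x0 / L z0 - 1" using L[OF 0(1)] L[OF 0(2)] by (intro ln_le_minus_one) simp
    finally have "1 / L z0 \<le> (L x0 - L z0) / L z0"
      using L[OF 0(2)] by (simp add: diff_divide_distrib)
    then have "1 \<le> L x0 - L z0" using L[OF 0(2)] by (simp add: divide_le_cancel)
    moreover have "ln (d z0 / 2) \<le> ln (d x0)"
      using d_lip[of z0 x0] eq d_pos[OF 0(2)] by (intro ln_mono) simp_all
    then have "L x0 - L z0 \<le> ln 2"
      using d_pos[OF 0(2)] by (simp add: L_def ln_div)
    ultimately show False using ln_2_less_1 by simp
  qed
  have "\<Phi> ((x0, z0), t0) \<le> \<epsilon>"
  proof (cases "t0 = 0")
    case True
    then show ?thesis using \<Phi>_le[OF 0(2,5), of x0] v_init[OF 0(1)] \<epsilon> by simp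
  next
    case False
    \<comment> \<open>With \<open>z\<close> frozen at \<open>z0\<close>, the blow-up term is a
      constant, and maximizing \<Phi> in (x, t) amounts to touching \<open>v\<close> by the test
      function.\<close>
    have \<Phi>_eq: "\<Phi> ((x, z0), t) = v (x, t) - quad_test (\<eta> * c z0) z0 \<epsilon> T (x, t) - \<eta> * ln (L z0)" for x t
      by (simp add: \<Phi>_def quad_test_def dot_square_norm algebra_simps)
    \<comment> \<open>The slack in the constraint: moving \<open>x0\<close> by less than
      \<open>s\<close> keeps the pair with \<open>z0\<close> admissible.\<close>
    define s where "s = d z0 / 2 - norm (x0 - z0)"
    have "v w - quad_test (\<eta> * c z0) z0 \<epsilon> T w \<le> v (x0, t0) - quad_test (\<eta> * c z0) z0 \<epsilon> T (x0, t0)"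
      if "w \<in> \<Omega> \<times> {0<..<T} \<inter> ball (x0, t0) s" for w
    proof -
      obtain x t where w_pair: "w = (x, t)" by (cases w)
      with that have w: "w = (x, t)" "x \<in> \<Omega>" "0 < t" "t < T" by auto
      have "norm (x0 - x) < s"
        using that dist_fst_le[of "(x0, t0)" w] by (auto simp: w dist_norm)
      then have "norm (x - z0) \<le> d z0 / 2"
        using norm_triangle_ineq[of "x - x0" "x0 - z0"] by (simp add: s_def norm_minus_commute)
      then have "\<Phi> ((x, z0), t) \<le> \<Phi> ((x0, z0), t0)"
        using w 0 by (intro max) (simp add: D_def)
      then show ?thesis by (simp add: \<Phi>_eq w)
    qed
    moreover have "s > 0" using strict by (simp add: s_def)
    ultimately have "local_max_at (\<Omega> \<times> {0<..<T}) (\<lambda>w. v w - quad_test (\<eta> * c z0) z0 \<epsilon> T w) (x0, t0)"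
      using 0 False unfolding local_max_at_def by auto
    then have "v (x0, t0) \<le> \<epsilon>"
      using 0 False d_mono by (intro touch[of x0 z0 t0]) (auto simp: c_def)
    then show ?thesis using \<Phi>_le[OF 0(2,5), of x0] by simp
  qed
  then have "\<Phi> ((x, x), t) \<le> \<epsilon>" using max[OF start] by simp
  then show ?thesis by (simp add: \<Phi>_def L_def)
qed

section \<open>Passage to the limit and conclusion\<close>

text \<open>The admissible range of \<eta> depends on \<epsilon>, so \<epsilon> is fixed first and
  \<eta> is made small afterwards; each error takes half of the tolerance \<open>e\<close>. The
  denominators contain 1 + c and 1 + g because \<open>c\<close> and \<open>g\<close> may
  vanish.\<close>

lemma nonpos_if_le_small:
  fixes v g c :: real
  assumes "g \<ge> 0" "c \<ge> 0"
    and le: "\<And>\<epsilon>. \<epsilon> > 0 \<Longrightarrow> \<exists>\<eta>\<^sub>0>0. \<forall>\<eta>. 0 < \<eta> \<longrightarrow> \<eta> \<le> \<eta>\<^sub>0 \<longrightarrow> v \<le> \<epsilon> + \<eta> * g + \<epsilon> * c"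
  shows "v \<le> 0"
proof (rule field_le_epsilon)
  fix e :: real assume "e > 0"
  define \<epsilon> where "\<epsilon> = e / (2 * (1 + c))"
  have "\<epsilon> > 0" using \<open>e > 0\<close> assms by (simp add: \<epsilon>_def)
  then obtain \<eta>\<^sub>0 where \<eta>\<^sub>0: "\<eta>\<^sub>0 > 0" "\<And>\<eta>. 0 < \<eta> \<Longrightarrow> \<eta> \<le> \<eta>\<^sub>0 \<Longrightarrow> v \<le> \<epsilon> + \<eta> * g + \<epsilon> * c"
    using le by blast
  define \<eta> where "\<eta> = min \<eta>\<^sub>0 (e / (2 * (1 + g)))"
  have "\<eta> * g \<le> e / (2 * (1 + g)) * g"
    using assms by (intro mult_right_mono) (auto simp: \<eta>_def)
  also have "\<dots> \<le> e / (2 * (1 + g)) * (1 + g)"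
    using assms \<open>e > 0\<close> by (intro mult_left_mono) auto
  also have "\<dots> = e / 2" using assms by (simp add: divide_simps)
  finally have "\<eta> * g \<le> e / 2" .
  moreover have "\<epsilon> + \<epsilon> * c = e / 2"
  proof -
    have "\<epsilon> + \<epsilon> * c = \<epsilon> * (1 + c)" by (simp add: algebra_simps)
    then show ?thesis using assms by (simp add: \<epsilon>_def divide_simps)
  qed
  moreover have "v \<le> \<epsilon> + \<eta> * g + \<epsilon> * c"
    using \<eta>\<^sub>0(1) \<open>e > 0\<close> assms by (intro \<eta>\<^sub>0(2)) (auto simp: \<eta>_def)
  ultimately show "v \<le> 0 + e" by simp
qed

theorem theorem4p5:
  fixes \<Omega> :: "(real ^ 'n) set"
    and F :: "real ^ 'n \<Rightarrow> real ^ 'n \<Rightarrow> real ^ 'n ^ 'n \<Rightarrow> real"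
    and T :: real
    and u :: "(real ^ 'n) \<times> real \<Rightarrow> real"
  defines "d \<equiv> boundary_dist \<Omega>"
  assumes T: "T > 0"
    and domain: "bounded_C2_domain \<Omega>"
    and i: "continuous_on (\<Omega> \<times> UNIV \<times> sym_mats) (\<lambda>(x, p, X). F x p X)"
    and ii: "\<forall>x\<in>\<Omega>. \<forall>p. \<forall>X\<in>sym_mats. \<forall>Y\<in>sym_mats. Y \<preceq> X \<longrightarrow> F x p X \<le> F x p Y"
    and iii: "\<forall>\<omega>. modulus_of_continuity \<omega> \<longrightarrow>
      ((\<lambda>\<delta>. SUP (x, p, X) \<in> {(x, p, X). x \<in> \<Omega> \<and> X \<in> sym_mats \<and> d x \<le> \<delta> \<and>
                norm p \<le> \<omega> \<delta> / \<delta> \<and> norm X \<le> \<omega> \<delta> / \<delta>\<^sup>2}. ereal \<bar>F x p X\<bar>)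
        \<longlongrightarrow> 0) (at_right 0)"
    and iv: "((\<lambda>(p, X). SUP x\<in>\<Omega>. ereal \<bar>F x p X\<bar>) \<longlongrightarrow> 0)
        (at (0, 0) within UNIV \<times> sym_mats)"
    and v: "\<exists>a\<^sub>F>0. \<exists>L>0. \<exists>\<alpha>\<in>{0<..1}. \<exists>\<beta>\<in>{0<..<1}. \<forall>M>0. \<forall>\<delta>>0.
      \<forall>x\<in>\<Omega>. \<forall>y\<in>\<Omega>. \<forall>p q. \<forall>X\<in>sym_mats. \<forall>Y\<in>sym_mats.
        x \<noteq> y \<longrightarrow>
        F x p X \<le> M \<longrightarrow> - M \<le> F y q Y \<longrightarrow>
        norm (p - (\<alpha> * a\<^sub>F * norm (x - y) powr (\<alpha> - 2)) *\<^sub>R (x - y)) \<le> \<delta> / d x \<longrightarrow>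
        norm (q - (\<alpha> * a\<^sub>F * norm (x - y) powr (\<alpha> - 2)) *\<^sub>R (x - y)) \<le> \<delta> / d y \<longrightarrow>
        (\<exists>A\<in>sym_mats.
          A \<preceq> (\<alpha> * a\<^sub>F * norm (x - y) powr (\<alpha> - 2)) *\<^sub>R mat 1 \<and>
          block_mat X 0 0 (- Y) \<preceq>
            block_mat A (- A) (- A) A
            + \<delta> *\<^sub>R block_mat ((1 / (d x)\<^sup>2) *\<^sub>R mat 1) 0 0 ((1 / (d y)\<^sup>2) *\<^sub>R mat 1)
            + \<delta> *\<^sub>R mat 1) \<longrightarrow>
        F y q Y - F x p X \<le> \<beta> * a\<^sub>F * norm (x - y) powr \<alpha> + L * \<delta>"
    and vi: "\<exists>b\<^sub>F>0. \<exists>l>0. \<forall>c>0. \<forall>\<delta>>0.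
      \<forall>x\<in>\<Omega>. \<forall>y\<in>\<Omega>. \<forall>p q. \<forall>X\<in>sym_mats. \<forall>Y\<in>sym_mats.
        norm (p - c *\<^sub>R (x - y)) \<le> \<delta> / d x \<longrightarrow>
        norm (q - c *\<^sub>R (x - y)) \<le> \<delta> / d y \<longrightarrow>
        block_mat X 0 0 (- Y) \<preceq>
          c *\<^sub>R block_mat (mat 1) (- mat 1) (- mat 1) (mat 1)
          + \<delta> *\<^sub>R block_mat ((1 / (d x)\<^sup>2) *\<^sub>R mat 1) 0 0 ((1 / (d y)\<^sup>2) *\<^sub>R mat 1)
          + \<delta> *\<^sub>R mat 1 \<longrightarrow>
        F y q Y - F x p X \<le> b\<^sub>F * c * (norm (x - y))\<^sup>2 + l * \<delta>"
    and u_cont: "continuous_on (\<Omega> \<times> {0..<T}) u"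
    and u_bounded: "bounded (u ` (\<Omega> \<times> {0..<T}))"
    and u_sol: "viscosity_solution \<Omega> T F u"
    and u_init: "\<forall>x\<in>\<Omega>. u (x, 0) = 0"
    and u_modulus: "\<exists>\<omega>\<^sub>0. modulus_of_continuity \<omega>\<^sub>0 \<and> strict_mono_on {0<..} \<omega>\<^sub>0 \<and>
      (\<forall>k. \<forall>t>0. (deriv ^^ k) \<omega>\<^sub>0 differentiable at t) \<and>
      (\<forall>t\<in>{0..<T}. (SUP x\<in>\<Omega>. \<bar>u (x, t)\<bar>) \<le> \<omega>\<^sub>0 t)"
  shows "\<forall>x\<in>\<Omega>. \<forall>t\<in>{0<..<T}. u (x, t) = 0"
proof -
  have dom: "open \<Omega>" "bounded \<Omega>" "\<Omega> \<noteq> {}"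
    using domain by (auto simp: bounded_C2_domain_def)
  \<comment> \<open>\<open>infdist\<close> to the empty set is 0, so positivity of \<open>d\<close>
    needs a boundary point. Only the empty set and the whole space have empty frontier.\<close>
  have fr: "frontier \<Omega> \<noteq> {}"
    using dom not_bounded_UNIV by (auto simp: frontier_eq_empty)
  have d_pos: "d x > 0" if "x \<in> \<Omega>" for x
  proof -
    have "x \<notin> frontier \<Omega>" using that dom by (simp add: frontier_def interior_open)
    then have "infdist x (frontier \<Omega>) \<noteq> 0"
      using in_closed_iff_infdist_zero[OF frontier_closed fr] by simp
    then show ?thesis
      using infdist_nonneg[of x "frontier \<Omega>"] by (simp add: d_def boundary_dist_def)
  qed
  obtain y where y: "y \<in> frontier \<Omega>" using fr by blast
  obtain R where R: "\<And>x. x \<in> \<Omega> \<Longrightarrow> d x \<le> R"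
  proof -
    obtain e where "\<And>x. x \<in> \<Omega> \<Longrightarrow> dist y x \<le> e"
      using dom(2) bounded_any_center[of \<Omega> y] by auto
    then have "d x \<le> e" if "x \<in> \<Omega>" for x
      using that infdist_le[OF y, of x]
      unfolding d_def boundary_dist_def by (metis dist_commute order_trans)
    then show thesis by (rule that)
  qed
  have Rpos: "R > 0" using dom(3) R d_pos by (metis ex_in_conv less_le_trans)
  obtain B where B: "\<And>w. w \<in> \<Omega> \<times> {0..<T} \<Longrightarrow> \<bar>u w\<bar> \<le> B"
    using u_bounded by (auto simp: bounded_iff)
  define F' where "F' \<eta> x z = F x ((2 * (\<eta> * penalty R (d z))) *\<^sub>R (x - z))
    ((2 * (\<eta> * penalty R (d z))) *\<^sub>R mat 1)" for \<eta> x z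
  \<comment> \<open>The time derivative of the test function is nonnegative and can be discarded,
    which leaves u <= -F.\<close>
  have sub: "u (x, t) \<le> \<epsilon>"
    if "\<epsilon> > 0" "t < T" and F: "\<bar>F' \<eta> x z\<bar> < \<epsilon>"
      and max: "local_max_at (\<Omega> \<times> {0<..<T}) (\<lambda>w. u w - quad_test (\<eta> * penalty R (d z)) z \<epsilon> T w) (x, t)"
    for x z t \<epsilon> \<eta>
  proof -
    have "parabolic_op F u (quad_test (\<eta> * penalty R (d z)) z \<epsilon> T) x t \<le> 0"
      using u_sol max C2_on_quad_test
      unfolding viscosity_solution_def viscosity_subsolution_def by blast
    moreover have "\<epsilon> / (T - t)\<^sup>2 \<ge> 0" using that by simp
    ultimately show ?thesis
      using F unfolding parabolic_op_quad_test[OF \<open>t < T\<close>] F'_def by linarith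
  qed
  \<comment> \<open>A maximum for \<open>- u\<close> is a minimum for \<open>u\<close> against the
    negated test function; negating its coefficients is why \<open>F'\<close> appears at
    -\<eta>.\<close>
  have super: "- u (x, t) \<le> \<epsilon>"
    if "\<epsilon> > 0" "t < T" and F: "\<bar>F' (- \<eta>) x z\<bar> < \<epsilon>"
      and max: "local_max_at (\<Omega> \<times> {0<..<T}) (\<lambda>w. - u w - quad_test (\<eta> * penalty R (d z)) z \<epsilon> T w) (x, t)"
    for x z t \<epsilon> \<eta>
  proof -
    have "local_min_at (\<Omega> \<times> {0<..<T})
        (\<lambda>w. u w - quad_test (- (\<eta> * penalty R (d z))) z (- \<epsilon>) T w) (x, t)"
      using local_min_at_uminus[OF max] by (simp add: quad_test_uminus add.commute)
    then have "0 \<le> parabolic_op F u (quad_test (- (\<eta> * penalty R (d z))) z (- \<epsilon>) T) x t"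
      using u_sol C2_on_quad_test
      unfolding viscosity_solution_def viscosity_supersolution_def by blast
    moreover have "\<epsilon> / (T - t)\<^sup>2 \<ge> 0" using that by simp
    ultimately show ?thesis
      using F unfolding parabolic_op_quad_test[OF \<open>t < T\<close>] F'_def divide_minus_left mult_minus_left
      by linarith
  qed
  show ?thesis
  proof (intro ballI)
    fix x t assume x: "x \<in> \<Omega>" and t: "t \<in> {0<..<T}"
    define g where "g = ln (1 + ln R - ln (d x))"
    have g: "g \<ge> 0" using log_ge_1[OF d_pos R, OF x x] by (simp add: g_def)
    have le: "\<exists>\<eta>\<^sub>0>0. \<forall>\<eta>. 0 < \<eta> \<longrightarrow> \<eta> \<le> \<eta>\<^sub>0 \<longrightarrow> \<bar>u (x, t)\<bar> \<le> \<epsilon> + \<eta> * g + \<epsilon> * (1 / (T - t))"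
      if "\<epsilon> > 0" for \<epsilon>
    proof -
      obtain \<eta>\<^sub>0 where \<eta>\<^sub>0: "\<eta>\<^sub>0 > 0" "\<And>\<eta> x z. \<lbrakk>\<eta> \<noteq> 0; \<bar>\<eta>\<bar> \<le> \<eta>\<^sub>0; x \<in> \<Omega>; 0 < d z; d z \<le> R; d x \<le> d z;
          norm (x - z) \<le> d z / 2\<rbrakk> \<Longrightarrow> \<bar>F' \<eta> x z\<bar> < \<epsilon>"
        unfolding F'_def using operator_small_on_quad_test[OF iii[rule_format] iv Rpos \<open>\<epsilon> > 0\<close>] by blast
      have "\<bar>u (x, t)\<bar> \<le> \<epsilon> + \<eta> * g + \<epsilon> / (T - t)" if \<eta>: "0 < \<eta>" "\<eta> \<le> \<eta>\<^sub>0" for \<eta>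
      proof -
        \<comment> \<open>The placeholders stand for the three premises about \<open>v\<close>,
          which differ between \<open>u\<close> and \<open>- u\<close>.\<close>
        note hyps = dom(1,2) d_pos[unfolded d_def] R[unfolded d_def] _ _ _ \<eta>(1) \<open>\<epsilon> > 0\<close>
        have "u (x, t) \<le> \<epsilon> + \<eta> * g + \<epsilon> / (T - t)" unfolding g_def d_def
        proof (rule penalized_doubling_bound[where B = B, OF hyps])
          fix x z t
          assume H: "x \<in> \<Omega>" "z \<in> \<Omega>" "t \<in> {0<..<T}" "boundary_dist \<Omega> x \<le> boundary_dist \<Omega> z"
            "norm (x - z) \<le> boundary_dist \<Omega> z / 2"
            "local_max_at (\<Omega> \<times> {0<..<T})
              (\<lambda>w. u w - quad_test (\<eta> * penalty R (boundary_dist \<Omega> z)) z \<epsilon> T w) (x, t)"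
          have "\<bar>F' \<eta> x z\<bar> < \<epsilon>" using H \<eta> R d_pos by (intro \<eta>\<^sub>0(2)) (auto simp: d_def)
          then show "u (x, t) \<le> \<epsilon>" using sub[OF \<open>\<epsilon> > 0\<close>] H by (simp add: d_def)
        next
          show "u w \<le> B" if "w \<in> \<Omega> \<times> {0..<T}" for w using B[OF that] by simp
        qed (use u_cont u_init x t in auto)
        moreover have "- u (x, t) \<le> \<epsilon> + \<eta> * g + \<epsilon> / (T - t)" unfolding g_def d_def
        proof (rule penalized_doubling_bound[where v = "\<lambda>w. - u w" and B = B, OF hyps])
          fix x z t
          assume H: "x \<in> \<Omega>" "z \<in> \<Omega>" "t \<in> {0<..<T}" "boundary_dist \<Omega> x \<le> boundary_dist \<Omega> z"
            "norm (x - z) \<le> boundary_dist \<Omega> z / 2"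
            "local_max_at (\<Omega> \<times> {0<..<T})
              (\<lambda>w. - u w - quad_test (\<eta> * penalty R (boundary_dist \<Omega> z)) z \<epsilon> T w) (x, t)"
          have "\<bar>F' (- \<eta>) x z\<bar> < \<epsilon>" using H \<eta> R d_pos by (intro \<eta>\<^sub>0(2)) (auto simp: d_def)
          then show "- u (x, t) \<le> \<epsilon>" using super[OF \<open>\<epsilon> > 0\<close>] H by (simp add: d_def)
        next
          show "- u w \<le> B" if "w \<in> \<Omega> \<times> {0..<T}" for w using B[OF that] by simp
          show "continuous_on (\<Omega> \<times> {0..<T}) (\<lambda>w. - u w)" by (intro continuous_intros u_cont)
        qed (use u_init x t in auto)
        ultimately show ?thesis by simp
      qed
      then show ?thesis using \<eta>\<^sub>0(1) by auto
    qed
    have "\<bar>u (x, t)\<bar> \<le> 0"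
      using t by (intro nonpos_if_le_small[OF g _ le]) auto
    then show "u (x, t) = 0" by simp
  qed
qed

end
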